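(* Let $d\ge1$ and $k\ge1$ be integers and let $G=(V,D)$ be a $k$-fold $\mathcal{R}_d$-circuit with at most two technicolour vertices. Then $G$ is a balanced $k$-fold $\mathcal{R}_d$-circuit.
   Context: For a graph $G=(V,E)$ and a generic $p:V\to\mathbb{R}^d$ (coordinates algebraically independent over $\mathbb{Q}$), the rigidity matrix $R(G,p)$ is the $|E|\times d|V|$ matrix whose row for $uv\in E$ has $p(u)-p(v)$ in the $d$ columns of $u$, $p(v)-p(u)$ in the $d$ columns of $v$, and zeros elsewhere. The generic $d$-dimensional rigidity matroid $\mathcal{R}_d$ is the row matroid of this matrix for the complete graph on a vertex set containing $V$; its rank function is $r_d$ and closure operator $\mathrm{cl}(X)=\{x: r_d(X\cup\{x\})=r_d(X)\}$. Graphs are identified with their edge sets. A set $D$ of edges is cyclic if it is a union of circuits of $\mathcal{R}_d$. For $k\ge0$, a graph $G=(V,D)$ is a $k$-fold $\mathcal{R}_d$-circuit if $D$ is cyclic and $r_d(D)=|D|-k$. For $k\ge1$, the principal partition of $D$ is the partition $\{A_1,\dots,A_\ell\}$ of $D$ such that $\{D\setminus A_i\}$ is exactly the set of $(k-1)$-fold $\mathcal{R}_d$-circuits contained in $D$. A vertex is technicolour if it is incident with edges of $D$ from at least two different parts of the principal partition, and monochromatic otherwise. $G$ is balanced if $r_d\big(\bigcap_{i=1}^\ell \mathrm{cl}(D\setminus A_i)\big)=\ell-k$. *)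

theory Defs
  imports Complex_Main
begin

definition is_edge :: "'a set \<Rightarrow> bool" where
  "is_edge e \<longleftrightarrow> card e = 2"

definition verts :: "'a set set \<Rightarrow> 'a set" where
  "verts X = \<Union> X"

text \<open>Algebraic independence over Q of a finite family x indexed by I:
no nonzero polynomial with rational coefficients (given as a finite sum of
distinct monomials in the variables of I) vanishes at x.\<close>

definition alg_indep_Q :: "('i \<Rightarrow> real) \<Rightarrow> 'i set \<Rightarrow> bool" where
  "alg_indep_Q x I \<longleftrightarrow>
     (\<forall>M c. finite M \<longrightarrow> (\<forall>m\<in>M. \<forall>i. i \<notin> I \<longrightarrow> m i = (0::nat)) \<longrightarrow>
        (\<forall>m\<in>M. c m \<in> \<rat>) \<longrightarrow>
        (\<Sum>m\<in>M. c m * (\<Prod>i\<in>I. x i ^ m i)) = 0 \<longrightarrow> (\<forall>m\<in>M. c m = 0))"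

definition generic :: "nat \<Rightarrow> 'a set \<Rightarrow> ('a \<Rightarrow> nat \<Rightarrow> real) \<Rightarrow> bool" where
  "generic d V p \<longleftrightarrow> alg_indep_Q (\<lambda>(v, i). p v i) (V \<times> {0..<d})"

text \<open>Row of the rigidity matrix for edge e = uv, column (w,i):
p(w)_i - p(other endpoint)_i if w is an endpoint, else 0.\<close>

definition rig_row :: "nat \<Rightarrow> ('a \<Rightarrow> nat \<Rightarrow> real) \<Rightarrow> 'a set \<Rightarrow> 'a \<times> nat \<Rightarrow> real" where
  "rig_row d p e = (\<lambda>(w, i). if w \<in> e \<and> i < d then (\<Sum>z\<in>e - {w}. p w i - p z i) else 0)"

definition rows_lin_indep :: "nat \<Rightarrow> ('a \<Rightarrow> nat \<Rightarrow> real) \<Rightarrow> 'a set set \<Rightarrow> bool" where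
  "rows_lin_indep d p Y \<longleftrightarrow>
     (\<forall>c. (\<forall>col. (\<Sum>e\<in>Y. c e * rig_row d p e col) = 0) \<longrightarrow> (\<forall>e\<in>Y. c e = 0))"

definition matrix_rank :: "nat \<Rightarrow> ('a \<Rightarrow> nat \<Rightarrow> real) \<Rightarrow> 'a set set \<Rightarrow> nat" where
  "matrix_rank d p X = Max {card Y | Y. Y \<subseteq> X \<and> rows_lin_indep d p Y}"

definition rig_rank :: "nat \<Rightarrow> 'a set set \<Rightarrow> nat" where
  "rig_rank d X = matrix_rank d (SOME p. generic d (verts X) p) X"

definition rig_cl :: "nat \<Rightarrow> 'a set set \<Rightarrow> 'a set set" where
  "rig_cl d X = {x. is_edge x \<and> rig_rank d (insert x X) = rig_rank d X}"

definition rig_indep :: "nat \<Rightarrow> 'a set set \<Rightarrow> bool" where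
  "rig_indep d X \<longleftrightarrow> rig_rank d X = card X"

definition rig_circuit :: "nat \<Rightarrow> 'a set set \<Rightarrow> bool" where
  "rig_circuit d C \<longleftrightarrow> finite C \<and> (\<forall>e\<in>C. is_edge e) \<and> \<not> rig_indep d C \<and>
     (\<forall>e\<in>C. rig_indep d (C - {e}))"

definition cyclic :: "nat \<Rightarrow> 'a set set \<Rightarrow> bool" where
  "cyclic d D \<longleftrightarrow> (\<forall>e\<in>D. \<exists>C. C \<subseteq> D \<and> rig_circuit d C \<and> e \<in> C)"

definition k_fold_circuit :: "nat \<Rightarrow> nat \<Rightarrow> 'a set set \<Rightarrow> bool" where
  "k_fold_circuit d k D \<longleftrightarrow> finite D \<and> (\<forall>e\<in>D. is_edge e) \<and> cyclic d D \<and>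
     rig_rank d D + k = card D"

definition principal_partition :: "nat \<Rightarrow> nat \<Rightarrow> 'a set set \<Rightarrow> 'a set set set \<Rightarrow> bool" where
  "principal_partition d k D P \<longleftrightarrow>
     \<Union> P = D \<and> (\<forall>A\<in>P. A \<noteq> {}) \<and> (\<forall>A\<in>P. \<forall>B\<in>P. A \<noteq> B \<longrightarrow> A \<inter> B = {}) \<and>
     (\<lambda>A. D - A) ` P = {H. H \<subseteq> D \<and> k_fold_circuit d (k - 1) H}"

definition technicolour :: "'a set set set \<Rightarrow> 'a \<Rightarrow> bool" where
  "technicolour P v \<longleftrightarrow>
     (\<exists>A\<in>P. \<exists>B\<in>P. A \<noteq> B \<and> (\<exists>e\<in>A. v \<in> e) \<and> (\<exists>e\<in>B. v \<in> e))"

definition balanced :: "nat \<Rightarrow> nat \<Rightarrow> 'a set set \<Rightarrow> 'a set set set \<Rightarrow> bool" where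
  "balanced d k D P \<longleftrightarrow>
     int (rig_rank d (\<Inter>A\<in>P. rig_cl d (D - A))) = int (card P) - int k"

end

theory Submission
  imports
    Defs
    "HOL-Library.Function_Algebras"
    "HOL-Computational_Algebra.Polynomial"
    "HOL-Analysis.Continuum_Not_Denumerable"
begin

text \<open>Fix a generic \<open>p\<close> on \<open>V\<close> and let \<open>W\<^sub>A\<close> be the span of the rows of \<open>D - A\<close>, a subspace of
  codimension \<open>card A - 1\<close> in the row space of \<open>D\<close>. By the modular law the intersection \<open>U\<close> of all
  \<open>W\<^sub>A\<close> has dimension exactly \<open>card P - k\<close>. A monochromatic vertex is missed by some \<open>D - A\<close>, so the
  vectors of \<open>U\<close> are supported on the technicolour vertices. Being equilibrium forces supported
  on at most two vertices, they are multiples of the row of the single edge \<open>e\<close> joining these.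
  Hence if \<open>U\<close> is nonzero, then \<open>e\<close> lies in every \<open>cl (D - A)\<close>, and in all cases \<open>U\<close> is spanned by the
  rows of the edges in the intersection of these closures.\<close>

section \<open>Linear algebra of row vectors\<close>

definition fscale :: "real \<Rightarrow> ('c \<Rightarrow> real) \<Rightarrow> 'c \<Rightarrow> real" where
  "fscale c f = (\<lambda>x. c * f x)"

interpretation fn: vector_space fscale
  by unfold_locales (auto simp: fscale_def fun_eq_iff algebra_simps)

lemma fscale_sum_apply: "(\<Sum>e\<in>Y. fscale (c e) (r e)) x = (\<Sum>e\<in>Y. c e * r e x)"
  by (induction Y rule: infinite_finite_induct) (auto simp: fscale_def)

text \<open>The ambient function space may be infinite-dimensional, so the count stays inside the
  span of a finite \<open>S\<close>, which is the sum of \<open>U\<close> and \<open>W\<close>. A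
  basis \<open>B\<close> of \<open>U \<inter> W\<close> grows to \<open>C\<close> for
  \<open>U\<close>, then by vectors of \<open>W\<close> to \<open>E\<close> for the sum;
  \<open>B\<close> and \<open>E - C\<close> together form a basis of \<open>W\<close>.\<close>

lemma fn_dim_modular:
  assumes U: "fn.subspace U" and W: "fn.subspace W" and S: "finite S" "W \<subseteq> fn.span S"
    and UW: "U \<subseteq> fn.span S" "S \<subseteq> fn.span (U \<union> W)"
  shows "fn.dim (U \<inter> W) + fn.dim S = fn.dim U + fn.dim W"
proof -
  obtain B where B: "B \<subseteq> U \<inter> W" "fn.independent B" "U \<inter> W \<subseteq> fn.span B"
    using fn.maximal_independent_subset by blast
  obtain C where C: "B \<subseteq> C" "C \<subseteq> U" "fn.independent C" "U \<subseteq> fn.span C"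
    using fn.maximal_independent_subset_extend[of B U] B by blast
  obtain E where E: "C \<subseteq> E" "E \<subseteq> C \<union> W" "fn.independent E" "C \<union> W \<subseteq> fn.span E"
    using fn.maximal_independent_subset_extend[of C "C \<union> W"] C by blast
  have spC: "fn.span C = U"
    using C(2,4) fn.span_minimal[OF _ U] by blast
  have ES: "E \<subseteq> fn.span S" using E(2) C(2) S UW by blast
  have finE: "finite E" using fn.independent_span_bound[OF S(1) E(3) ES] by simp
  have "U \<union> W \<subseteq> fn.span E"
    using E(1,4) fn.span_mono[of C E] spC by blast
  hence "fn.span (U \<union> W) \<subseteq> fn.span E" by (simp add: fn.span_minimal)
  hence dS: "fn.dim S = card E"
    using fn.dim_eq_card[of E S] E(3) UW(2) ES
      fn.span_minimal[of S "fn.span E"] fn.span_minimal[of E "fn.span S"] by auto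
  have sub: "B \<union> (E - C) \<subseteq> W" using B(1) E(2) by blast
  \<comment> \<open>Subtracting from \<open>w\<close> its component in the span of
    \<open>E - C\<close>, which lies in \<open>W\<close>, leaves a vector of
    \<open>U \<inter> W\<close>, hence one spanned by \<open>B\<close>.\<close>
  have "W \<subseteq> fn.span (B \<union> (E - C))"
  proof
    fix w assume w: "w \<in> W"
    have "E = C \<union> (E - C)" using E(1) by blast
    hence "w \<in> fn.span (C \<union> (E - C))" using E(4) w by auto
    then obtain c e where ce: "c \<in> fn.span C" "e \<in> fn.span (E - C)" "w = c + e"
      unfolding fn.span_Un by blast
    have "E - C \<subseteq> W" using E(2) by blast
    hence "e \<in> W" using ce(2) fn.span_minimal[OF _ W] by blast
    hence "w - e \<in> W" using w W fn.subspace_diff by blast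
    moreover have "c = w - e" using ce by simp
    ultimately have "c \<in> U \<inter> W" using ce(1) spC by auto
    hence "c \<in> fn.span B" using B by blast
    thus "w \<in> fn.span (B \<union> (E - C))" using ce(2,3) unfolding fn.span_Un by blast
  qed
  moreover have "fn.independent (B \<union> (E - C))"
    by (rule fn.independent_mono[OF E(3)]) (use C(1) E(1) in blast)
  ultimately have "fn.dim W = card (B \<union> (E - C))"
    by (rule fn.basis_card_eq_dim[OF sub, symmetric])
  also have "\<dots> = card B + card (E - C)"
    using finE C(1) E(1) finite_subset[of B E] by (intro card_Un_disjoint) auto
  finally have "fn.dim W = card B + card (E - C)" .
  moreover have "card E = card C + card (E - C)"
    using card_Diff_subset[of C E] card_mono[OF finE E(1)] finite_subset[OF E(1) finE] E(1) by simp
  moreover have "fn.dim U = card C" using fn.basis_card_eq_dim[OF C(2,4,3)] by simp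
  moreover have "fn.dim (U \<inter> W) = card B" using fn.basis_card_eq_dim[OF B(1,3,2)] by simp
  ultimately show ?thesis using dS by simp
qed

section \<open>Independent families of rows and matrix rank\<close>

definition indep_rows :: "('e \<Rightarrow> 'c \<Rightarrow> real) \<Rightarrow> 'e set \<Rightarrow> bool" where
  "indep_rows r Y \<longleftrightarrow> (\<forall>c. (\<forall>x. (\<Sum>e\<in>Y. c e * r e x) = 0) \<longrightarrow> (\<forall>e\<in>Y. c e = 0))"

lemma rows_lin_indep_iff: "rows_lin_indep d p Y \<longleftrightarrow> indep_rows (rig_row d p) Y"
  by (simp add: rows_lin_indep_def indep_rows_def)

text \<open>Two equal rows satisfy a relation with coefficients \<open>1\<close> and
  \<open>- 1\<close>, so an independent family has no repetitions. Without repetitions, coefficients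
  transfer between indices and rows.\<close>

lemma indep_rows_iff:
  assumes "finite Y"
  shows "indep_rows r Y \<longleftrightarrow> inj_on r Y \<and> fn.independent (r ` Y)" (is "?L \<longleftrightarrow> ?R")
proof
  assume "?L"
  hence L: "\<forall>c. (\<forall>x. (\<Sum>e\<in>Y. c e * r e x) = 0) \<longrightarrow> (\<forall>e\<in>Y. c e = 0)"
    by (simp add: indep_rows_def)
  have inj: "inj_on r Y"
  proof (rule inj_onI, rule ccontr)
    fix a b assume ab: "a \<in> Y" "b \<in> Y" "r a = r b" "a \<noteq> b"
    define c where "c = (\<lambda>e. if e = a then 1 else if e = b then - 1 else 0 :: real)"
    have "(\<Sum>e\<in>Y. c e * r e x) = 0" for x
    proof -
      have "(\<Sum>e\<in>Y. c e * r e x) = (\<Sum>e\<in>{a,b}. c e * r e x)"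
        using ab assms by (intro sum.mono_neutral_right) (auto simp: c_def)
      also have "\<dots> = 0" using ab by (simp add: c_def)
      finally show ?thesis .
    qed
    with L ab(1) have "c a = 0" by blast
    thus False by (simp add: c_def)
  qed
  moreover have "fn.independent (r ` Y)"
  proof
    assume "fn.dependent (r ` Y)"
    then obtain u v where u: "v \<in> r ` Y" "u v \<noteq> 0" "(\<Sum>v\<in>r ` Y. fscale (u v) v) = 0"
      using assms by (auto simp: fn.dependent_finite)
    have "(\<Sum>e\<in>Y. fscale (u (r e)) (r e)) = 0" using u(3) by (simp add: sum.reindex[OF inj])
    hence "(\<Sum>e\<in>Y. u (r e) * r e x) = 0" for x
      using fscale_sum_apply[where Y = Y and c = "\<lambda>e. u (r e)" and r = r] by (metis zero_fun_apply)
    with spec[OF L, of "\<lambda>e. u (r e)"] have "\<forall>e\<in>Y. u (r e) = 0" by blast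
    with u show False by auto
  qed
  ultimately show ?R ..
next
  assume R: ?R
  show ?L
    unfolding indep_rows_def
  proof (intro allI impI ballI)
    fix c e assume c: "\<forall>x. (\<Sum>e\<in>Y. c e * r e x) = 0" and e: "e \<in> Y"
    have "(\<Sum>e\<in>Y. fscale (c e) (r e)) = 0"
      using c by (auto simp: fun_eq_iff fscale_sum_apply)
    hence "(\<Sum>v\<in>r ` Y. fscale (c (inv_into Y r v)) v) = 0"
      using R by (simp add: sum.reindex)
    from fn.independentD[OF _ _ subset_refl this, of "r e"] R assms e
    show "c e = 0" by simp
  qed
qed

text \<open>A basis picked from the rows lifts to a set of edges attaining the maximum; by the
  exchange bound no independent set is larger.\<close>

lemma matrix_rank_eq_dim:
  assumes "finite X"
  shows "matrix_rank d p X = fn.dim (rig_row d p ` X)"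
proof -
  have iff: "rows_lin_indep d p Y \<longleftrightarrow> inj_on (rig_row d p) Y \<and> fn.independent (rig_row d p ` Y)"
    if "Y \<subseteq> X" for Y
    unfolding rows_lin_indep_iff by (rule indep_rows_iff[OF finite_subset[OF that assms]])
  obtain B where B: "B \<subseteq> rig_row d p ` X" "fn.independent B" "rig_row d p ` X \<subseteq> fn.span B"
    "card B = fn.dim (rig_row d p ` X)"
    using fn.basis_exists by blast
  obtain Y where Y: "Y \<subseteq> X" "inj_on (rig_row d p) Y" "rig_row d p ` Y = B"
    using B(1) by (metis subset_image_inj)
  have "Max {card Y | Y. Y \<subseteq> X \<and> rows_lin_indep d p Y} = fn.dim (rig_row d p ` X)"
  proof (rule Max_eqI)
    have "{card Y | Y. Y \<subseteq> X \<and> rows_lin_indep d p Y} \<subseteq> card ` Pow X" by auto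
    thus "finite {card Y | Y. Y \<subseteq> X \<and> rows_lin_indep d p Y}"
      using assms by (simp add: finite_subset)
    show "fn.dim (rig_row d p ` X) \<in> {card Y | Y. Y \<subseteq> X \<and> rows_lin_indep d p Y}"
      using B Y iff card_image[OF Y(2)] by (intro CollectI exI[of _ Y]) auto
  next
    fix n assume "n \<in> {card Y | Y. Y \<subseteq> X \<and> rows_lin_indep d p Y}"
    then obtain Z where Z: "n = card Z" "Z \<subseteq> X" "inj_on (rig_row d p) Z" "fn.independent (rig_row d p ` Z)"
      using iff by auto
    have "finite B" using B(1) assms by (simp add: finite_subset)
    hence "card (rig_row d p ` Z) \<le> card B"
      using fn.independent_span_bound[of B "rig_row d p ` Z"] Z B(3) by (meson image_mono subset_trans)
    thus "n \<le> fn.dim (rig_row d p ` X)" using Z B(4) by (simp add: card_image)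
  qed
  thus ?thesis by (simp add: matrix_rank_def)
qed

text \<open>Turns closure, which is defined by ranks, into membership in a span: a vector outside
  the span enlarges a basis of \<open>S\<close> by one.\<close>

lemma fn_dim_insert_iff:
  assumes "finite S"
  shows "fn.dim (insert x S) = fn.dim S \<longleftrightarrow> x \<in> fn.span S"
proof
  assume "x \<in> fn.span S"
  thus "fn.dim (insert x S) = fn.dim S" by (metis fn.dim_span fn.span_redundant)
next
  assume eq: "fn.dim (insert x S) = fn.dim S"
  show "x \<in> fn.span S"
  proof (rule ccontr)
    assume x: "x \<notin> fn.span S"
    obtain B where B: "B \<subseteq> S" "fn.independent B" "S \<subseteq> fn.span B" "card B = fn.dim S"
      using fn.basis_exists by blast
    have sp: "fn.span B = fn.span S"
      using B fn.span_mono[of B S] fn.span_minimal[of S "fn.span B"] by auto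
    have "fn.independent (insert x B)" using B(2) x sp by (simp add: fn.independent_insertI)
    moreover have "insert x S \<subseteq> fn.span (insert x B)"
      using B(3) fn.span_mono[of B "insert x B"] fn.span_base[of x "insert x B"] by blast
    ultimately have "fn.dim (insert x S) = card (insert x B)"
      using B(1) fn.basis_card_eq_dim[of "insert x B" "insert x S"] by (metis insert_mono)
    moreover have "x \<notin> B" "finite B" using x sp fn.span_base finite_subset[OF B(1) assms] by auto
    ultimately show False using eq B(4) by simp
  qed
qed

section \<open>Generic points\<close>

text \<open>The values at \<open>x\<close> and \<open>y\<close> of one and the same integer
  polynomial without constant term. Differences and products are the operations of division-free
  elimination, and \<open>zero\<close> covers the zero entries of a row.\<close>

inductive poly_pair :: "('i \<Rightarrow> real) \<Rightarrow> ('i \<Rightarrow> real) \<Rightarrow> 'i set \<Rightarrow> real \<Rightarrow> real \<Rightarrow> bool"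
  for x y I where
  zero: "poly_pair x y I 0 0"
| var: "i \<in> I \<Longrightarrow> poly_pair x y I (x i) (y i)"
| diff: "poly_pair x y I a b \<Longrightarrow> poly_pair x y I a' b' \<Longrightarrow> poly_pair x y I (a - a') (b - b')"
| mult: "poly_pair x y I a b \<Longrightarrow> poly_pair x y I a' b' \<Longrightarrow> poly_pair x y I (a * a') (b * b')"

lemma poly_pair_commute: "poly_pair x y I a b \<Longrightarrow> poly_pair y x I b a"
  by (induction rule: poly_pair.induct) (auto intro: poly_pair.intros)

definition monomial_sum :: "('i \<Rightarrow> nat) set \<Rightarrow> (('i \<Rightarrow> nat) \<Rightarrow> real) \<Rightarrow> 'i set \<Rightarrow> ('i \<Rightarrow> real) \<Rightarrow> real" where
  "monomial_sum M c I x = (\<Sum>m\<in>M. c m * (\<Prod>i\<in>I. x i ^ m i))"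

definition rat_poly :: "('i \<Rightarrow> nat) set \<Rightarrow> (('i \<Rightarrow> nat) \<Rightarrow> real) \<Rightarrow> 'i set \<Rightarrow> bool" where
  "rat_poly M c I \<longleftrightarrow> finite M \<and> (\<forall>m\<in>M. \<forall>i. i \<notin> I \<longrightarrow> m i = 0) \<and> (\<forall>m\<in>M. c m \<in> \<rat>)"

lemma alg_indep_Q_iff:
  "alg_indep_Q x I \<longleftrightarrow> (\<forall>M c. rat_poly M c I \<longrightarrow> monomial_sum M c I x = 0 \<longrightarrow> (\<forall>m\<in>M. c m = 0))"
  by (simp add: alg_indep_Q_def rat_poly_def monomial_sum_def) blast

text \<open>\<open>M\<close> and \<open>c\<close> do not depend on the point, so a single polynomial
  yields both values.\<close>

lemma poly_pair_imp_rat_poly: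
  assumes "finite I" "poly_pair x y I a b"
  shows "\<exists>M c. rat_poly M c I \<and> a = monomial_sum M c I x \<and> b = monomial_sum M c I y"
  using assms(2)
proof (induction rule: poly_pair.induct)
  case zero
  show ?case by (rule exI[of _ "{}"]) (auto simp: rat_poly_def monomial_sum_def)
next
  case (var i)
  let ?m = "\<lambda>k. if k = i then 1 else 0 :: nat"
  have "(\<Prod>k\<in>I. z k ^ ?m k) = z i" for z :: "_ \<Rightarrow> real"
  proof -
    have "(\<Prod>k\<in>I. z k ^ ?m k) = (\<Prod>k\<in>I. if k = i then z k else 1)" by (intro prod.cong) auto
    thus ?thesis using var assms(1) by simp
  qed
  thus ?case using var
    by (intro exI[of _ "{?m}"] exI[of _ "\<lambda>_. 1"]) (auto simp: rat_poly_def monomial_sum_def)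
next
  case (diff a b a' b')
  then obtain M c M' c' where h: "rat_poly M c I" "a = monomial_sum M c I x" "b = monomial_sum M c I y"
    "rat_poly M' c' I" "a' = monomial_sum M' c' I x" "b' = monomial_sum M' c' I y" by blast
  let ?c = "\<lambda>m. (if m \<in> M then c m else 0) - (if m \<in> M' then c' m else 0)"
  have fin: "finite M" "finite M'" using h by (auto simp: rat_poly_def)
  have "monomial_sum (M \<union> M') ?c I z = monomial_sum M c I z - monomial_sum M' c' I z" for z
  proof -
    have ext: "monomial_sum N e I z = (\<Sum>m\<in>M \<union> M'. (if m \<in> N then e m else 0) * (\<Prod>i\<in>I. z i ^ m i))"
      if "N \<subseteq> M \<union> M'" for N and e :: "_ \<Rightarrow> real"
      unfolding monomial_sum_def using fin that by (intro sum.mono_neutral_cong_left) auto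
    show ?thesis
      using ext[of M c] ext[of M' c'] by (simp add: monomial_sum_def left_diff_distrib sum_subtractf)
  qed
  moreover have "rat_poly (M \<union> M') ?c I" using h(1,4) by (auto simp: rat_poly_def)
  ultimately show ?case using h(2,3,5,6) by (intro exI[of _ "M \<union> M'"] exI[of _ ?c]) simp
next
  case (mult a b a' b')
  then obtain M c M' c' where h: "rat_poly M c I" "a = monomial_sum M c I x" "b = monomial_sum M c I y"
    "rat_poly M' c' I" "a' = monomial_sum M' c' I x" "b' = monomial_sum M' c' I y" by blast
  let ?f = "\<lambda>(m, m'). m + m'"
  let ?S = "M \<times> M'"
  \<comment> \<open>Pairs of exponents with the same sum contribute to the same monomial, so
    coefficients are summed over the fibres of addition.\<close>
  let ?c = "\<lambda>n. \<Sum>q\<in>{q\<in>?S. ?f q = n}. c (fst q) * c' (snd q)"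
  have fin: "finite ?S" using h by (auto simp: rat_poly_def)
  have "monomial_sum (?f ` ?S) ?c I z = monomial_sum M c I z * monomial_sum M' c' I z" for z
  proof -
    let ?g = "\<lambda>q. c (fst q) * c' (snd q) * (\<Prod>i\<in>I. z i ^ (?f q i))"
    have "monomial_sum M c I z * monomial_sum M' c' I z = sum ?g ?S"
      unfolding monomial_sum_def sum_product sum.cartesian_product
      by (intro sum.cong) (auto simp: power_add prod.distrib)
    also have "\<dots> = (\<Sum>n\<in>?f ` ?S. \<Sum>q\<in>{q\<in>?S. ?f q = n}. ?g q)"
      by (rule sum.image_gen[OF fin])
    also have "\<dots> = monomial_sum (?f ` ?S) ?c I z"
      unfolding monomial_sum_def sum_distrib_right by (intro sum.cong) auto
    finally show ?thesis by simp
  qed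
  moreover have "rat_poly (?f ` ?S) ?c I"
    unfolding rat_poly_def
  proof (intro conjI ballI allI impI)
    show "finite (?f ` ?S)" using fin by simp
    show "m i = 0" if "m \<in> ?f ` ?S" "i \<notin> I" for m i using that h(1,4) by (auto simp: rat_poly_def)
    show "?c m \<in> \<rat>" for m using h(1,4) by (intro Rats_sum Rats_mult) (auto simp: rat_poly_def)
  qed
  ultimately show ?case using h(2,3,5,6) by (intro exI[of _ "?f ` ?S"] exI[of _ ?c]) simp
qed

text \<open>Algebraic independence at \<open>x\<close> kills every coefficient, so the polynomial
  vanishes at any \<open>y\<close> as well.\<close>

lemma poly_pair_zero:
  assumes "finite I" "alg_indep_Q x I" "poly_pair x y I a b" "a = 0"
  shows "b = 0"
proof -
  obtain M c where "rat_poly M c I" "a = monomial_sum M c I x" "b = monomial_sum M c I y"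
    using poly_pair_imp_rat_poly[OF assms(1,3)] by blast
  moreover from this assms have "\<forall>m\<in>M. c m = 0" by (auto simp: alg_indep_Q_iff)
  ultimately show ?thesis by (simp add: monomial_sum_def)
qed

section \<open>Restriction and existence of algebraically independent points\<close>

lemma alg_indep_Q_subset:
  assumes "alg_indep_Q x J" "I \<subseteq> J" "finite J"
  shows "alg_indep_Q x I"
  unfolding alg_indep_Q_iff
proof (intro allI impI)
  fix M c assume h: "rat_poly M c I" "monomial_sum M c I x = 0"
  have "(\<Prod>i\<in>J. x i ^ m i) = (\<Prod>i\<in>I. x i ^ m i)" if "m \<in> M" for m
    using h(1) that assms(2,3) by (intro prod.mono_neutral_right) (auto simp: rat_poly_def)
  hence "monomial_sum M c J x = 0" using h(2) by (simp add: monomial_sum_def)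
  moreover have "rat_poly M c J" using h(1) assms(2) by (auto simp: rat_poly_def)
  ultimately show "\<forall>m\<in>M. c m = 0" using assms(1) by (auto simp: alg_indep_Q_iff)
qed

text \<open>Only countably many reals are roots of nonzero polynomials with coefficients in
  \<open>K\<close>, so some \<open>t\<close> avoids them all. \<open>K\<close> holds the values of
  rational polynomials at \<open>x\<close>; the new countable \<open>K'\<close> lets the extension
  be iterated.\<close>

lemma alg_indep_Q_extend:
  fixes x :: "'i \<Rightarrow> real"
  assumes I: "finite I" "j \<notin> I" "alg_indep_Q x I"
    and K: "countable K" "\<And>M c. finite M \<Longrightarrow> c ` M \<subseteq> \<rat> \<Longrightarrow> monomial_sum M c I x \<in> K"
  shows "\<exists>t K'. alg_indep_Q (x(j := t)) (insert j I) \<and> countable K' \<and>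
    (\<forall>M c. finite M \<longrightarrow> c ` M \<subseteq> \<rat> \<longrightarrow> monomial_sum M c (insert j I) (x(j := t)) \<in> K')"
proof -
  define bad where "bad = (\<Union>L\<in>{L\<in>lists K. Poly L \<noteq> 0}. {t. poly (Poly L) t = 0})"
  have "countable {L\<in>lists K. Poly L \<noteq> 0}"
    by (rule countable_subset[OF _ countable_lists[OF K(1)]]) auto
  hence "countable bad"
    unfolding bad_def by (rule countable_UN) (auto intro: countable_finite poly_roots_finite)
  hence "bad \<noteq> UNIV" using uncountable_UNIV_real by auto
  then obtain t where t: "t \<notin> bad" by blast
  \<comment> \<open>The polynomial read as one in the new variable \<open>j\<close> alone, the other
    variables being evaluated at \<open>x\<close>; its coefficients lie in \<open>K\<close>.\<close>
  define q where "q M c = (\<Sum>m\<in>M. monom (c m * (\<Prod>i\<in>I. x i ^ m i)) (m j))"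
    for M and c :: "('i \<Rightarrow> nat) \<Rightarrow> real"
  have coeff_q: "coeff (q M c) n = monomial_sum {m\<in>M. m j = n} c I x" if "finite M" for M c n
  proof -
    have "coeff (q M c) n = (\<Sum>m\<in>M. if m j = n then c m * (\<Prod>i\<in>I. x i ^ m i) else 0)"
      by (simp add: q_def coeff_sum)
    thus ?thesis using that by (simp add: monomial_sum_def sum.If_cases Int_def)
  qed
  have val: "monomial_sum M c (insert j I) (x(j := t)) = poly (q M c) t" for M c
  proof -
    have "(\<Prod>i\<in>I. (x(j := t)) i ^ m i) = (\<Prod>i\<in>I. x i ^ m i)" for m :: "'i \<Rightarrow> nat"
      using I(2) by (intro prod.cong) auto
    thus ?thesis using I(1,2)
      by (simp add: monomial_sum_def q_def poly_sum poly_monom mult_ac)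
  qed
  have inK: "coeffs (q M c) \<in> lists K" if "finite M" "c ` M \<subseteq> \<rat>" for M c
  proof -
    have "coeff (q M c) n \<in> K" for n
      unfolding coeff_q[OF that(1)] using that by (intro K(2)) auto
    moreover have "set (coeffs (q M c)) \<subseteq> range (coeff (q M c))"
      by (auto simp: coeffs_def)
    ultimately show ?thesis by blast
  qed
  have "alg_indep_Q (x(j := t)) (insert j I)"
    unfolding alg_indep_Q_iff
  proof (intro allI impI ballI)
    fix M c m0 assume h: "rat_poly M c (insert j I)" "monomial_sum M c (insert j I) (x(j := t)) = 0"
      and m0: "m0 \<in> M"
    have fin: "finite M" and rat: "c ` M \<subseteq> \<rat>" using h(1) by (auto simp: rat_poly_def)
    have "poly (q M c) t = 0" using h(2) val by simp
    hence q0: "q M c = 0"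
      using t inK[OF fin rat] unfolding bad_def by auto
    \<comment> \<open>The coefficient of \<open>q M c\<close> in the degree that \<open>m0\<close>
      has in \<open>j\<close> is the value of the monomials in \<open>N\<close>. Erasing their
      common exponent \<open>n\<close> keeps them distinct and leaves monomials over
      \<open>I\<close>, where independence of \<open>x\<close> applies.\<close>
    define n where "n = m0 j"
    define N where "N = {m\<in>M. m j = n}"
    have inj: "inj_on (\<lambda>m. m(j := 0)) N"
      by (rule inj_on_inverseI[of _ "\<lambda>m. m(j := n)"]) (auto simp: N_def)
    have N: "(m(j := 0))(j := n) = m" if "m \<in> N" for m using that by (auto simp: N_def)
    let ?N' = "(\<lambda>m. m(j := 0)) ` N" and ?c' = "\<lambda>m. c (m(j := n))"
    have "(\<Prod>i\<in>I. x i ^ (m(j := 0)) i) = (\<Prod>i\<in>I. x i ^ m i)" for m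
      using I(2) by (intro prod.cong) auto
    hence "monomial_sum ?N' ?c' I x = monomial_sum N c I x"
      unfolding monomial_sum_def sum.reindex[OF inj] using N by (intro sum.cong) auto
    also have "\<dots> = 0" using q0 coeff_q[OF fin, of c n] by (simp add: N_def)
    finally have "monomial_sum ?N' ?c' I x = 0" .
    moreover have "rat_poly ?N' ?c' I"
      using h(1) N unfolding rat_poly_def by (auto simp: N_def)
    ultimately have "\<forall>m\<in>?N'. ?c' m = 0" using I(3) unfolding alg_indep_Q_iff by blast
    moreover have "m0 \<in> N" using m0 by (simp add: N_def n_def)
    ultimately show "c m0 = 0" using N[of m0] by auto
  qed
  moreover have "countable ((\<lambda>L. poly (Poly L) t) ` lists K)" using K(1) by simp
  moreover have "monomial_sum M c (insert j I) (x(j := t)) \<in> (\<lambda>L. poly (Poly L) t) ` lists K"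
    if "finite M" "c ` M \<subseteq> \<rat>" for M c
    unfolding val using inK[OF that] by (intro image_eqI[of _ _ "coeffs (q M c)"]) auto
  ultimately show ?thesis by blast
qed

lemma alg_indep_Q_exists:
  assumes "finite I"
  shows "\<exists>x. alg_indep_Q x I"
proof -
  have "\<exists>x K. alg_indep_Q x I \<and> countable K \<and>
    (\<forall>M c. finite M \<longrightarrow> c ` M \<subseteq> \<rat> \<longrightarrow> monomial_sum M c I x \<in> K)"
    using assms
  proof (induction I)
    case empty
    have "alg_indep_Q (x :: 'a \<Rightarrow> real) {}" for x
      unfolding alg_indep_Q_iff
    proof (intro allI impI)
      fix M and c :: "('a \<Rightarrow> nat) \<Rightarrow> real"
      assume h: "rat_poly M c {}" "monomial_sum M c {} x = 0"
      hence "M \<subseteq> {\<lambda>_. 0}" by (auto simp: rat_poly_def)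
      hence "M = {} \<or> M = {\<lambda>_. 0}" by blast
      thus "\<forall>m\<in>M. c m = 0" using h(2) by (auto simp: monomial_sum_def)
    qed
    moreover have "monomial_sum M c {} x \<in> \<rat>" if "c ` M \<subseteq> \<rat>" for M c and x :: "'a \<Rightarrow> real"
      using that unfolding monomial_sum_def by (intro Rats_sum) auto
    ultimately show ?case
      by (intro exI[of _ "\<lambda>_. 0"] exI[of _ \<rat>] conjI allI impI countable_rat) simp_all
  next
    case (insert j I)
    then obtain x K where "alg_indep_Q x I" "countable K"
      "\<And>M c. finite M \<Longrightarrow> c ` M \<subseteq> \<rat> \<Longrightarrow> monomial_sum M c I x \<in> K" by blast
    from alg_indep_Q_extend[OF insert(1,2) this] show ?case by blast
  qed
  thus ?thesis by blast
qed

text \<open>One elimination step without division: row \<open>e\<close> is multiplied by the pivot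
  \<open>a e0 c0\<close> and a multiple of row \<open>e0\<close> is subtracted to clear column
  \<open>c0\<close>. Relations can be carried back and forth because the pivot is nonzero.\<close>

lemma indep_rows_pivot:
  assumes Y: "finite Y" "e0 \<notin> Y" and c0: "a e0 c0 \<noteq> 0"
  shows "indep_rows a (insert e0 Y) \<longleftrightarrow>
    indep_rows (\<lambda>e c. a e0 c0 * a e c - a e c0 * a e0 c) Y" (is "_ \<longleftrightarrow> indep_rows ?b Y")
proof
  assume L: "indep_rows a (insert e0 Y)"
  show "indep_rows ?b Y"
    unfolding indep_rows_def
  proof (intro allI impI ballI)
    fix l e assume l: "\<forall>c. (\<Sum>e\<in>Y. l e * ?b e c) = 0" and e: "e \<in> Y"
    define m where "m = (\<lambda>e. if e = e0 then - (\<Sum>e\<in>Y. l e * a e c0) else l e * a e0 c0)"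
    have "(\<Sum>e\<in>insert e0 Y. m e * a e c) = 0" for c
    proof -
      have "(\<Sum>e\<in>Y. m e * a e c) = (\<Sum>e\<in>Y. l e * a e0 c0 * a e c)"
        using Y by (intro sum.cong) (auto simp: m_def)
      moreover have "(\<Sum>e\<in>Y. l e * ?b e c) = (\<Sum>e\<in>Y. l e * a e0 c0 * a e c) - (\<Sum>e\<in>Y. l e * a e c0) * a e0 c"
        by (simp add: algebra_simps sum_subtractf sum_distrib_left)
      ultimately show ?thesis using l Y by (simp add: m_def)
    qed
    hence "m e = 0" using L e unfolding indep_rows_def by blast
    thus "l e = 0" using c0 Y e by (auto simp: m_def split: if_splits)
  qed
next
  assume R: "indep_rows ?b Y"
  show "indep_rows a (insert e0 Y)"
    unfolding indep_rows_def
  proof (intro allI impI)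
    fix m assume m: "\<forall>c. (\<Sum>e\<in>insert e0 Y. m e * a e c) = 0"
    have eq: "(\<Sum>e\<in>Y. m e * a e c) = - m e0 * a e0 c" for c
      using m[rule_format, of c] Y by simp
    have "(\<Sum>e\<in>Y. m e * ?b e c) = 0" for c
    proof -
      have "(\<Sum>e\<in>Y. m e * ?b e c) = a e0 c0 * (\<Sum>e\<in>Y. m e * a e c) - a e0 c * (\<Sum>e\<in>Y. m e * a e c0)"
        by (simp add: algebra_simps sum_subtractf sum_distrib_left)
      thus ?thesis by (simp add: eq)
    qed
    hence m0: "\<forall>e\<in>Y. m e = 0" using R unfolding indep_rows_def by blast
    hence "m e0 * a e0 c0 = 0" using m[rule_format, of c0] Y by simp
    thus "\<forall>e\<in>insert e0 Y. m e = 0" using c0 m0 by simp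
  qed
qed

text \<open>Fraction-free Gaussian elimination: a pivot at one generic point is a pivot at the other,
  since the entries stay rational polynomials in the coordinates.\<close>

lemma indep_rows_generic_cong:
  assumes I: "finite I" "alg_indep_Q x I" "alg_indep_Q y I"
    and "finite Y" and "\<And>e c. e \<in> Y \<Longrightarrow> poly_pair x y I (a e c) (b e c)"
  shows "indep_rows a Y \<longleftrightarrow> indep_rows b Y"
  using assms(4,5)
proof (induction Y arbitrary: a b)
  case empty
  show ?case by (simp add: indep_rows_def)
next
  case (insert e0 Y)
  have z: "a e0 c = 0 \<longleftrightarrow> b e0 c = 0" for c
    using poly_pair_zero[OF I(1,2) insert.prems[of e0 c]]
      poly_pair_zero[OF I(1,3) poly_pair_commute[OF insert.prems[of e0 c]]] by auto
  show ?case
  proof (cases "\<forall>c. a e0 c = 0")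
    case True
    have "\<not> indep_rows r (insert e0 Y)" if "\<And>c. r e0 c = 0" for r :: "'b \<Rightarrow> 'c \<Rightarrow> real"
    proof
      assume "indep_rows r (insert e0 Y)"
      moreover have "(\<Sum>e\<in>insert e0 Y. (if e = e0 then 1 else 0) * r e c) = 0" for c
        using that by (intro sum.neutral) auto
      ultimately show False
        unfolding indep_rows_def by (auto dest!: spec[of _ "\<lambda>e. if e = e0 then 1 else 0"])
    qed
    thus ?thesis using True z by blast
  next
    case False
    then obtain c0 where c0: "a e0 c0 \<noteq> 0" by blast
    have "indep_rows (\<lambda>e c. a e0 c0 * a e c - a e c0 * a e0 c) Y \<longleftrightarrow>
      indep_rows (\<lambda>e c. b e0 c0 * b e c - b e c0 * b e0 c) Y"
      by (intro insert.IH poly_pair.diff poly_pair.mult insert.prems) auto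
    thus ?thesis
      using indep_rows_pivot[OF insert(1,2), of a, OF c0]
        indep_rows_pivot[OF insert(1,2), of b c0] c0 z by simp
  qed
qed

section \<open>The generic rigidity matroid\<close>

lemma generic_exists: "finite V \<Longrightarrow> \<exists>p. generic d V p"
  using alg_indep_Q_exists[of "V \<times> {0..<d}"]
  by (auto simp: generic_def intro: exI[of _ "\<lambda>v i. x (v, i)" for x])

lemma generic_subset: "generic d V p \<Longrightarrow> U \<subseteq> V \<Longrightarrow> finite V \<Longrightarrow> generic d U p"
  unfolding generic_def by (rule alg_indep_Q_subset) auto

text \<open>The difference of the two coordinates is a polynomial with value \<open>1\<close> at the
  indicator point of \<open>(u, i)\<close>, so it cannot vanish at a generic point.\<close>

lemma generic_coordinate_neq:
  assumes "generic d V p" "finite V" "u \<in> V" "v \<in> V" "u \<noteq> v" "i < d"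
  shows "p u i \<noteq> p v i"
proof
  let ?x = "\<lambda>(v, i). p v i" and ?y = "\<lambda>(w, j). if w = u \<and> j = i then 1 else 0 :: real"
  let ?I = "V \<times> {0..<d}"
  assume "p u i = p v i"
  have "poly_pair ?x ?y ?I (?x (u, i) - ?x (v, i)) (?y (u, i) - ?y (v, i))"
    using assms by (intro poly_pair.diff poly_pair.var) auto
  from poly_pair_zero[OF _ _ this] show False
    using assms \<open>p u i = p v i\<close> by (auto simp: generic_def)
qed

lemma rig_row_pair:
  assumes "u \<noteq> v"
  shows "rig_row d p {u, v} (w, i) =
    (if i < d then if w = u then p u i - p v i else if w = v then p v i - p u i else 0 else 0)"
proof -
  have "{u, v} - {u} = {v}" "{u, v} - {v} = {u}" using assms by auto
  thus ?thesis using assms by (auto simp: rig_row_def)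
qed

lemma is_edgeE:
  assumes "is_edge e"
  obtains u v where "e = {u, v}" "u \<noteq> v"
  using assms by (auto simp: is_edge_def card_2_iff)

text \<open>Row entries are \<open>0\<close> or differences of coordinates, so elimination runs
  alike at any two generic points.\<close>

lemma rows_lin_indep_generic:
  assumes V: "finite V" "generic d V p" "generic d V q"
    and Y: "finite Y" "\<forall>e\<in>Y. is_edge e" "verts Y \<subseteq> V"
  shows "rows_lin_indep d p Y \<longleftrightarrow> rows_lin_indep d q Y"
  unfolding rows_lin_indep_iff
proof (rule indep_rows_generic_cong)
  let ?I = "V \<times> {0..<d}" and ?x = "\<lambda>(v, i). p v i" and ?y = "\<lambda>(v, i). q v i"
  show "finite ?I" "alg_indep_Q ?x ?I" "alg_indep_Q ?y ?I" "finite Y"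
    using V Y by (auto simp: generic_def)
  fix e and c :: "'a \<times> nat" assume e: "e \<in> Y"
  obtain w i where c: "c = (w, i)" by force
  obtain u v where uv: "e = {u, v}" "u \<noteq> v" using e Y(2) is_edgeE by metis
  hence "u \<in> V" "v \<in> V" using e Y(3) by (auto simp: verts_def)
  hence "poly_pair ?x ?y ?I (p a i - p b i) (q a i - q b i)" if "i < d" "a \<in> e" "b \<in> e" for a b
    using poly_pair.diff[OF poly_pair.var[of "(a, i)" ?I ?x ?y] poly_pair.var[of "(b, i)" ?I ?x ?y]] that uv
    by auto
  thus "poly_pair ?x ?y ?I (rig_row d p e c) (rig_row d q e c)"
    using uv by (auto simp: c rig_row_pair intro: poly_pair.zero)
qed

text \<open>\<open>rig_rank\<close> chooses a point anew for every edge set. One \<open>p\<close>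
  generic on all of \<open>V\<close> computes all these ranks, so that they become dimensions in one
  space.\<close>

lemma rig_rank_eq_dim:
  assumes V: "finite V" "generic d V p"
    and X: "finite X" "\<forall>e\<in>X. is_edge e" "verts X \<subseteq> V"
  shows "rig_rank d X = fn.dim (rig_row d p ` X)"
proof -
  let ?q = "SOME p. generic d (verts X) p"
  have fin: "finite (verts X)" using X(3) V(1) finite_subset by blast
  have q: "generic d (verts X) ?q" by (rule someI_ex[OF generic_exists[OF fin]])
  have p: "generic d (verts X) p" using generic_subset V X(3) by blast
  have "rows_lin_indep d ?q Y = rows_lin_indep d p Y" if Y: "Y \<subseteq> X" for Y
  proof (rule rows_lin_indep_generic[OF fin q p])
    show "finite Y" using Y X(1) finite_subset by blast
    show "\<forall>e\<in>Y. is_edge e" using Y X(2) by blast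
    show "verts Y \<subseteq> verts X" using Y by (auto simp: verts_def)
  qed
  hence "{card Y | Y. Y \<subseteq> X \<and> rows_lin_indep d ?q Y} = {card Y | Y. Y \<subseteq> X \<and> rows_lin_indep d p Y}"
    by auto
  hence "rig_rank d X = matrix_rank d p X"
    unfolding rig_rank_def matrix_rank_def by simp
  thus ?thesis by (simp add: matrix_rank_eq_dim X(1))
qed

lemma in_rig_cl_iff:
  assumes V: "finite V" "generic d V p"
    and X: "finite X" "\<forall>e\<in>X. is_edge e" "verts X \<subseteq> V" and x: "is_edge x" "x \<subseteq> V"
  shows "x \<in> rig_cl d X \<longleftrightarrow> rig_row d p x \<in> fn.span (rig_row d p ` X)"
proof -
  have "rig_rank d (insert x X) = fn.dim (insert (rig_row d p x) (rig_row d p ` X))"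
    using rig_rank_eq_dim[OF V, of "insert x X"] X x by (simp add: verts_def)
  moreover have "rig_rank d X = fn.dim (rig_row d p ` X)"
    by (rule rig_rank_eq_dim[OF V X])
  ultimately show ?thesis
    using x(1) X(1) by (simp add: rig_cl_def fn_dim_insert_iff)
qed

section \<open>Supports and equilibrium of vectors in the row space\<close>

lemma rig_row_span_support:
  assumes "y \<in> fn.span (rig_row d p ` X)" "w \<notin> verts X"
  shows "y (w, i) = 0"
proof -
  have "fn.subspace {y. y (w, i) = 0}" by (auto simp: fn.subspace_def fscale_def)
  moreover have "rig_row d p ` X \<subseteq> {y. y (w, i) = 0}"
    using assms(2) by (auto simp: rig_row_def verts_def)
  ultimately show ?thesis using fn.span_minimal assms(1) by blast
qed

text \<open>\<open>rig_cl\<close> ranges over all edges of the vertex type, so edges leaving the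
  graph must be excluded: at a vertex outside \<open>verts X\<close> the span has only zeros, while
  the row of \<open>x\<close> is nonzero at both its ends.\<close>

lemma rig_cl_subset_verts:
  assumes d: "d \<ge> 1" and X: "finite X" "\<forall>e\<in>X. is_edge e" and x: "x \<in> rig_cl d X"
  shows "x \<subseteq> verts X"
proof
  fix w assume w: "w \<in> x"
  let ?V = "x \<union> verts X"
  have edge: "is_edge x" using x by (simp add: rig_cl_def)
  have "finite e" if "is_edge e" for e :: "'a set"
    using that unfolding is_edge_def by (metis card.infinite zero_neq_numeral)
  hence V: "finite ?V" using X edge by (auto simp: verts_def)
  then obtain p where p: "generic d ?V p" using generic_exists by blast
  have span: "rig_row d p x \<in> fn.span (rig_row d p ` X)"
    using in_rig_cl_iff[OF V p X _ edge] x by simp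
  obtain v where v: "x = {w, v}" "w \<noteq> v"
    using edge w by (elim is_edgeE) auto
  have "rig_row d p x (w, 0) \<noteq> 0"
    using generic_coordinate_neq[OF p V, of w v 0] v d by (simp add: rig_row_pair)
  thus "w \<in> verts X" using rig_row_span_support[OF span] by blast
qed

text \<open>Row vectors are orthogonal to every infinitesimal rigid motion, here to the translations and
  the rotations of the coordinate planes.\<close>

lemma rig_row_span_equilibrium:
  assumes V: "finite V" and X: "\<forall>e\<in>X. is_edge e" "verts X \<subseteq> V"
    and y: "y \<in> fn.span (rig_row d p ` X)"
  shows "(\<Sum>w\<in>V. y (w, i)) = 0"
    and "i < d \<Longrightarrow> j < d \<Longrightarrow> (\<Sum>w\<in>V. p w i * y (w, j)) = (\<Sum>w\<in>V. p w j * y (w, i))"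
    and "i \<ge> d \<Longrightarrow> y (w, i) = 0"
proof -
  \<comment> \<open>Pairing a row with vertex weights \<open>f\<close>. Constant weights give the
    translations; with a coordinate as weight the value is symmetric in the two coordinates, which
    gives the rotations.\<close>
  have row: "(\<Sum>w\<in>V. f w * rig_row d p e (w, i)) =
      (if i < d then (f u - f v) * (p u i - p v i) else 0)"
    if "e \<in> X" "e = {u, v}" "u \<noteq> v" for f i e u v
  proof -
    have "u \<in> V" "v \<in> V" using that X by (auto simp: verts_def)
    hence "(\<Sum>w\<in>V. f w * rig_row d p e (w, i)) = (\<Sum>w\<in>{u, v}. f w * rig_row d p e (w, i))"
      using V that by (intro sum.mono_neutral_right) (auto simp: rig_row_pair)
    thus ?thesis using that by (simp add: rig_row_pair algebra_simps)
  qed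
  have mem: "y \<in> S" if "fn.subspace S" "rig_row d p ` X \<subseteq> S" for S
    using fn.span_minimal[OF that(2,1)] y by blast
  have "y \<in> {y. (\<Sum>w\<in>V. y (w, i)) = 0}"
  proof (rule mem)
    show "fn.subspace {y. (\<Sum>w\<in>V. y (w, i)) = 0}"
      by (auto simp: fn.subspace_def fscale_def sum.distrib sum_distrib_left[symmetric])
    show "rig_row d p ` X \<subseteq> {y. (\<Sum>w\<in>V. y (w, i)) = 0}"
    proof clarify
      fix e assume e: "e \<in> X"
      obtain u v where "e = {u, v}" "u \<noteq> v" using e X(1) is_edgeE by metis
      from row[OF e this, of "\<lambda>_. 1" i] show "(\<Sum>w\<in>V. rig_row d p e (w, i)) = 0" by simp
    qed
  qed
  thus "(\<Sum>w\<in>V. y (w, i)) = 0" by simp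
  show "(\<Sum>w\<in>V. p w i * y (w, j)) = (\<Sum>w\<in>V. p w j * y (w, i))" if ij: "i < d" "j < d"
  proof -
    have "y \<in> {y. (\<Sum>w\<in>V. p w i * y (w, j)) = (\<Sum>w\<in>V. p w j * y (w, i))}" (is "y \<in> ?S")
    proof (rule mem)
      show "fn.subspace ?S"
        by (auto simp: fn.subspace_def fscale_def sum.distrib algebra_simps sum_distrib_left[symmetric])
      show "rig_row d p ` X \<subseteq> ?S"
      proof clarify
        fix e assume e: "e \<in> X"
        obtain u v where "e = {u, v}" "u \<noteq> v" using e X(1) is_edgeE by metis
        from row[OF e this, of "\<lambda>w. p w i" j] row[OF e this, of "\<lambda>w. p w j" i] ij
        show "(\<Sum>w\<in>V. p w i * rig_row d p e (w, j)) = (\<Sum>w\<in>V. p w j * rig_row d p e (w, i))"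
          by simp
      qed
    qed
    thus ?thesis by simp
  qed
  show "y (w, i) = 0" if "i \<ge> d"
  proof -
    have "fn.subspace {y. y (w, i) = 0}" by (auto simp: fn.subspace_def fscale_def)
    hence "y \<in> {y. y (w, i) = 0}" using that by (intro mem) (auto simp: rig_row_def)
    thus ?thesis by simp
  qed
qed

text \<open>Zero total force rules out a single vertex and makes the forces at two vertices
  opposite; zero moment makes them parallel to the line through the two points. Such a vector is a
  multiple of the row of the edge.\<close>

lemma span_supported_on_two_vertices:
  assumes d: "d \<ge> 1" and V: "finite V" "generic d V p" and X: "\<forall>e\<in>X. is_edge e" "verts X \<subseteq> V"
    and y: "y \<in> fn.span (rig_row d p ` X)" "y \<noteq> 0"
    and T: "T \<subseteq> V" "card T \<le> 2" "\<And>w i. y (w, i) \<noteq> 0 \<Longrightarrow> w \<in> T"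
  obtains c where "is_edge T" "c \<noteq> 0" "y = fscale c (rig_row d p T)"
proof -
  note eq = rig_row_span_equilibrium[OF V(1) X y(1)]
  have finT: "finite T" using T(1) V(1) finite_subset by blast
  obtain u i where u: "y (u, i) \<noteq> 0" using y(2) by (auto simp: fun_eq_iff)
  have uT: "u \<in> T" using u T(3) by blast
  have sumT: "(\<Sum>w\<in>V. f w * y (w, j)) = (\<Sum>w\<in>T. f w * y (w, j))" for f j
    using V T(1,3) by (intro sum.mono_neutral_right) auto
  have "\<exists>v\<in>T. v \<noteq> u"
  proof (rule ccontr)
    assume "\<not> (\<exists>v\<in>T. v \<noteq> u)"
    hence "T = {u}" using uT by blast
    thus False using eq(1)[of i] sumT[of "\<lambda>_. 1" i] u by simp
  qed
  then obtain v where v: "v \<in> T" "v \<noteq> u" by blast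
  have Teq: "T = {u, v}"
    using card_seteq[OF finT, of "{u, v}"] uT v T(2) by auto
  have anti: "y (v, j) = - y (u, j)" for j
    using eq(1)[of j] sumT[of "\<lambda>_. 1" j] v unfolding Teq by simp
  have id: "i < d" using eq(3)[of i u] u by fastforce
  have ne: "p u i \<noteq> p v i"
    using generic_coordinate_neq[OF V(2,1) _ _ _ id, of u v] uT v T(1) by blast
  have par: "(p u i - p v i) * y (u, j) = (p u j - p v j) * y (u, i)" if "j < d" for j
    using eq(2)[OF id that] sumT[of "\<lambda>w. p w i" j] sumT[of "\<lambda>w. p w j" i] v(2)
    unfolding Teq by (simp add: anti algebra_simps)
  \<comment> \<open>Coordinate \<open>i\<close>, where \<open>y\<close> is nonzero at
    \<open>u\<close>, fixes the factor; genericity makes the denominator nonzero.\<close>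
  define c where "c = y (u, i) / (p u i - p v i)"
  have "y (w, j) = fscale c (rig_row d p T) (w, j)" for w j
  proof (cases "j < d")
    case True
    have "y (u, j) = c * (p u j - p v j)" using par[OF True] ne by (simp add: c_def field_simps)
    moreover have "y (w, j) = 0" if "w \<noteq> u" "w \<noteq> v" using T(3)[of w j] that Teq by auto
    ultimately show ?thesis
      using True v(2) anti[of j] by (auto simp: Teq rig_row_pair fscale_def algebra_simps)
  next
    case False
    thus ?thesis using eq(3)[of j w] v(2) by (simp add: Teq rig_row_pair fscale_def)
  qed
  hence "y = fscale c (rig_row d p T)" by (auto simp: fun_eq_iff)
  moreover have "is_edge T" using v by (simp add: Teq is_edge_def)
  moreover have "c \<noteq> 0" using u ne by (simp add: c_def)
  ultimately show thesis using that by blast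
qed

section \<open>Intersecting the spans of the complements\<close>

text \<open>\<open>w\<close> lies on an edge of \<open>D\<close>, in some part \<open>B\<close>; the
  hypothesis for \<open>B\<close> itself yields an edge at \<open>w\<close> in another part.\<close>

lemma technicolourI:
  assumes P: "\<Union> P = D" "P \<noteq> {}" and w: "\<And>A. A \<in> P \<Longrightarrow> w \<in> verts (D - A)"
  shows "technicolour P w"
proof -
  obtain A where A: "A \<in> P" using P(2) by blast
  obtain e B where e: "w \<in> e" "e \<in> B" "B \<in> P" using w[OF A] P(1) by (auto simp: verts_def)
  obtain e' C where e': "w \<in> e'" "e' \<in> C" "C \<in> P" "e' \<notin> B"
    using w[OF e(3)] P(1) by (auto simp: verts_def)
  thus ?thesis using e by (auto simp: technicolour_def)
qed

lemma fn_subspace_INT_span: "fn.subspace (\<Inter>A\<in>Q. fn.span (f A))"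
  by (intro fn.subspace_Inter) auto

text \<open>Adding the subspaces one at a time, the modular law applies with sum the whole row space,
  because the intersection so far still contains the rows of the next part.\<close>

lemma dim_INT_span_complement:
  assumes D: "finite D" and P: "\<Union> P = D" "\<forall>A\<in>P. \<forall>B\<in>P. A \<noteq> B \<longrightarrow> A \<inter> B = {}"
    and dim: "\<And>A. A \<in> P \<Longrightarrow> fn.dim (r ` (D - A)) + card A = fn.dim (r ` D) + 1"
    and Q: "finite Q" "Q \<subseteq> P"
  shows "fn.dim (fn.span (r ` D) \<inter> (\<Inter>A\<in>Q. fn.span (r ` (D - A)))) + (\<Sum>A\<in>Q. card A)
    = fn.dim (r ` D) + card Q"
  using Q
proof (induction Q)
  case empty
  \<comment> \<open>Over no parts the intersection is the whole function space; intersecting with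
    the row space of \<open>D\<close> gives the right start.\<close>
  show ?case by simp
next
  case (insert B Q)
  let ?W = "\<lambda>A. fn.span (r ` (D - A))"
  let ?U = "fn.span (r ` D) \<inter> (\<Inter>A\<in>Q. ?W A)"
  have B: "B \<in> P" "B \<subseteq> D" using insert.prems P(1) by auto
  have "r ` B \<subseteq> ?U"
  proof (intro Int_greatest INT_greatest)
    show "r ` B \<subseteq> fn.span (r ` D)" using B(2) fn.span_base by blast
    fix A assume "A \<in> Q"
    hence "A \<in> P" "A \<noteq> B" using insert.hyps insert.prems by auto
    hence "B \<subseteq> D - A" using P(2) B by blast
    thus "r ` B \<subseteq> ?W A" using fn.span_base by blast
  qed
  moreover have "r ` (D - B) \<subseteq> ?W B" by (rule fn.span_superset)
  ultimately have "r ` D \<subseteq> ?U \<union> ?W B" by blast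
  hence sub: "r ` D \<subseteq> fn.span (?U \<union> ?W B)"
    by (meson fn.span_superset subset_trans)
  have "fn.dim (?U \<inter> ?W B) + fn.dim (r ` D) = fn.dim ?U + fn.dim (?W B)"
  proof (rule fn_dim_modular[OF _ _ _ _ _ sub])
    show "fn.subspace ?U"
      by (intro fn.subspace_inter fn_subspace_INT_span fn.subspace_span)
    show "?W B \<subseteq> fn.span (r ` D)" by (intro fn.span_mono) auto
  qed (use D in auto)
  moreover have "?U \<inter> ?W B = fn.span (r ` D) \<inter> (\<Inter>A\<in>insert B Q. ?W A)" by auto
  ultimately show ?case
    using insert dim[OF B(1)] by simp
qed

section \<open>The dimension count and the rows that span the intersection\<close>

theorem theorem3p12:
  fixes d k :: nat and V :: "'a set" and D :: "'a set set" and P :: "'a set set set"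
  assumes "d \<ge> 1" and "k \<ge> 1"
    and "finite V" and "\<forall>e\<in>D. e \<subseteq> V"
    and "k_fold_circuit d k D"
    and "principal_partition d k D P"
    and "card {v \<in> V. technicolour P v} \<le> 2"
  shows "balanced d k D P"
proof -
  define T where "T = {v \<in> V. technicolour P v}"
  define J where "J = (\<Inter>A\<in>P. rig_cl d (D - A))"
  obtain p where p: "generic d V p" using generic_exists[OF assms(3)] by blast
  let ?r = "rig_row d p"
  define U where "U = (\<Inter>A\<in>P. fn.span (?r ` (D - A)))"
  have D: "finite D" "\<forall>e\<in>D. is_edge e" "verts D \<subseteq> V" "rig_rank d D + k = card D"
    using assms(4,5) by (auto simp: k_fold_circuit_def verts_def)
  have P: "\<Union> P = D" "\<forall>A\<in>P. \<forall>B\<in>P. A \<noteq> B \<longrightarrow> A \<inter> B = {}"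
    and PH: "(\<lambda>A. D - A) ` P = {H. H \<subseteq> D \<and> k_fold_circuit d (k - 1) H}"
    using assms(6) by (auto simp: principal_partition_def)
  have finP: "finite P" using P(1) D(1) finite_UnionD by blast
  \<comment> \<open>With \<open>k \<ge> 1\<close> the size of \<open>D\<close> exceeds its rank, so
    \<open>D\<close> is nonempty and has a part.\<close>
  have Pne: "P \<noteq> {}" using P(1) D(4) assms(2) by auto
  have DA: "finite (D - A)" "\<forall>e\<in>D - A. is_edge e" "verts (D - A) \<subseteq> V" for A
    using D by (auto simp: verts_def)
  have rank: "rig_rank d X = fn.dim (?r ` X)" if "X \<subseteq> D" for X
  proof (rule rig_rank_eq_dim[OF assms(3) p])
    show "finite X" using that D(1) finite_subset by blast
    show "\<forall>e\<in>X. is_edge e" using that D(2) by blast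
    show "verts X \<subseteq> V" using that D(3) by (auto simp: verts_def)
  qed
  \<comment> \<open>\<open>D\<close> has rank \<open>card D - k\<close> and \<open>D - A\<close> has
    rank \<open>card (D - A) - (k - 1)\<close>; the drop from \<open>k\<close> to
    \<open>k - 1\<close> accounts for the \<open>+ 1\<close>.\<close>
  have dimA: "fn.dim (?r ` (D - A)) + card A = fn.dim (?r ` D) + 1" if A: "A \<in> P" for A
  proof -
    have "k_fold_circuit d (k - 1) (D - A)" using PH A by blast
    hence "rig_rank d (D - A) + (k - 1) = card (D - A)" by (simp add: k_fold_circuit_def)
    moreover have "card (D - A) + card A = card D"
      using A P(1) D(1) by (metis Sup_upper card_Diff_subset card_mono finite_subset le_add_diff_inverse2)
    ultimately show ?thesis using D(4) rank[of D] rank[of "D - A"] assms(2) by simp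
  qed
  have "U \<subseteq> fn.span (?r ` D)"
    using Pne fn.span_mono[OF image_mono[OF Diff_subset], of ?r D] unfolding U_def by blast
  hence "fn.dim U + (\<Sum>A\<in>P. card A) = fn.dim (?r ` D) + card P"
    using dim_INT_span_complement[OF D(1) P dimA finP subset_refl] unfolding U_def
    by (simp add: Int_absorb1)
  \<comment> \<open>The parts partition \<open>D\<close>, so their sizes sum to
    \<open>card D = rig_rank d D + k\<close>, and the rank cancels from the dimension
    formula.\<close>
  moreover have "(\<Sum>A\<in>P. card A) = card D"
    using P D(1) card_Union_disjoint[of P] by (metis Sup_upper finite_subset disjnt_def pairwiseI)
  ultimately have dimU: "fn.dim U + k = card P" using D(4) rank[of D] by simp
  have tech: "w \<in> T" if "\<And>A. A \<in> P \<Longrightarrow> w \<in> verts (D - A)" for w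
    using technicolourI[OF P(1) Pne that] that Pne DA(3) unfolding T_def by blast
  have finT: "finite T" using assms(3) by (simp add: T_def)
  \<comment> \<open>The closures share at most one edge: the ends of such an edge are technicolour,
    and with at most two technicolour vertices the edge is \<open>T\<close> itself.\<close>
  have J: "is_edge x" "x = T" if x: "x \<in> J" for x
  proof -
    show edge: "is_edge x" using x Pne by (auto simp: J_def rig_cl_def)
    have "w \<in> T" if "w \<in> x" for w
      using rig_cl_subset_verts[OF assms(1) DA(1,2)] x that by (intro tech) (auto simp: J_def)
    thus "x = T"
      using card_seteq[OF finT, of x] edge assms(7) by (auto simp: is_edge_def T_def)
  qed
  have in_J: "x \<in> J \<longleftrightarrow> ?r x \<in> U" if "is_edge x" "x \<subseteq> V" for x
    using in_rig_cl_iff[OF assms(3) p DA that] by (simp add: J_def U_def)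
  have JV: "x \<subseteq> V" if "x \<in> J" for x using J(2)[OF that] by (auto simp: T_def)
  have "?r ` J \<subseteq> U" using in_J J JV by blast
  \<comment> \<open>A nonzero vector of \<open>U\<close> is supported on \<open>T\<close>, so it is
    a nonzero multiple of the row of \<open>T\<close>. That row then lies in \<open>U\<close> too,
    which puts \<open>T\<close> into \<open>J\<close>.\<close>
  moreover have "U \<subseteq> fn.span (?r ` J)"
  proof
    fix y assume y: "y \<in> U"
    show "y \<in> fn.span (?r ` J)"
    proof (cases "y = 0")
      case True
      thus ?thesis by (simp add: fn.span_zero)
    next
      case False
      have supp: "w \<in> T" if "y (w, i) \<noteq> 0" for w i
        using rig_row_span_support[of y d p _ w i] y that by (intro tech) (auto simp: U_def)
      obtain A where "A \<in> P" using Pne by blast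
      hence yA: "y \<in> fn.span (?r ` (D - A))" using y by (simp add: U_def)
      have T: "T \<subseteq> V" "card T \<le> 2" using assms(7) by (auto simp: T_def)
      obtain c where c: "is_edge T" "c \<noteq> 0" "y = fscale c (?r T)"
        using span_supported_on_two_vertices[OF assms(1,3) p DA(2,3) yA False T] supp by blast
      have "?r T = fscale (inverse c) y" using c(2,3) by simp
      hence "?r T \<in> U" using y fn.span_scale by (auto simp: U_def)
      hence "T \<in> J" using in_J c(1) T(1) by blast
      thus ?thesis using c(3) by (simp add: fn.span_base fn.span_scale)
    qed
  qed
  ultimately have "fn.dim U = fn.dim (?r ` J)"
    by (metis fn.span_eq_dim fn.span_mono fn.span_span subset_antisym)
  also have "\<dots> = rig_rank d J"
  proof (rule rig_rank_eq_dim[OF assms(3) p, symmetric])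
    show "finite J" using J(2) finite_subset[of J "{T}"] by blast
    show "\<forall>e\<in>J. is_edge e" "verts J \<subseteq> V" using J(1) JV by (auto simp: verts_def)
  qed
  finally show ?thesis using dimU by (simp add: balanced_def J_def)
qed

end
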